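(* Let $\beta_c=\frac{4\log 2}{n}$. There is a constant $c_4>0$ such that for any inverse temperatures $\beta_c=\beta_M\ge\cdots\ge\beta_0\ge0$ (with $M=n^{O(1)}$), the conductance $\Phi$ of the simulated tempering chain with distributions $\pi_{\beta_0},\dots,\pi_{\beta_M}$ for the 3-state mean-field ferromagnetic Potts model is at most $e^{-c_4 n}$.
   Context: 3-state mean-field Potts model: $V=\{1,\dots,n\}$ (complete graph), configurations $x\in\Omega=\{1,2,3\}^V$, $H(x)=\sum_{i<j}\delta_{x_i,x_j}$, $\pi_\beta(x)=e^{\beta H(x)}/Z(\beta)$; $\log$ is the natural logarithm. For a distribution $\rho$ on $\Omega$, the Metropolis chain $M_\rho$ proposes from $x$ the configuration $y$ obtained by setting a uniformly random vertex to a uniformly random spin, accepted with probability $\min(1,\rho(y)/\rho(x))$. Simulated tempering chain with distributions $\pi_i=\pi_{\beta_i}$: state space $\Omega\times\{0,\dots,M\}$; with probability $1/2$ a level move $(x,i)\to(x',i)$ with probability $\frac12M_{\pi_i}(x,x')$; otherwise a temperature move: choose $j=i\pm1$ with probability $1/2$ each (at the endpoints the single neighbor with probability $1/2$) and move to $(x,j)$ with probability $\min(1,\pi_j(x)/\pi_i(x))$. Stationary distribution $\pi_{st}(x,i)=\pi_i(x)/(M+1)$. Conductance of a reversible chain $P$ with stationary distribution $\pi$: $\Phi=\min_{S:\pi(S)\le1/2}\frac{\sum_{x\in S,y\notin S}\pi(x)P(x,y)}{\pi(S)}$. *)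

theory Defs
  imports Complex_Main "HOL-Library.FuncSet"
begin

definition potts_configs :: "nat \<Rightarrow> (nat \<Rightarrow> nat) set" where
  "potts_configs n = {1..n} \<rightarrow>\<^sub>E {1, 2, 3}"

definition potts_H :: "nat \<Rightarrow> (nat \<Rightarrow> nat) \<Rightarrow> nat" where
  "potts_H n x = (\<Sum>j\<in>{1..n}. \<Sum>i\<in>{1..<j}. if x i = x j then 1 else 0)"

definition potts_Z :: "nat \<Rightarrow> real \<Rightarrow> real" where
  "potts_Z n \<beta> = (\<Sum>x\<in>potts_configs n. exp (\<beta> * real (potts_H n x)))"

definition potts_gibbs :: "nat \<Rightarrow> real \<Rightarrow> (nat \<Rightarrow> nat) \<Rightarrow> real" where
  "potts_gibbs n \<beta> x = exp (\<beta> * real (potts_H n x)) / potts_Z n \<beta>"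

text \<open>
  The transition matrix on the finite set \<open>X\<close> whose off-diagonal entries are given by \<open>Q\<close>;
  the remaining probability is the probability of staying put.
\<close>
definition chain_of_moves :: "'a set \<Rightarrow> ('a \<Rightarrow> 'a \<Rightarrow> real) \<Rightarrow> 'a \<Rightarrow> 'a \<Rightarrow> real" where
  "chain_of_moves X Q x y = (if x = y then 1 - (\<Sum>z\<in>X - {x}. Q x z) else Q x y)"

definition spin_proposal :: "nat \<Rightarrow> (nat \<Rightarrow> nat) \<Rightarrow> (nat \<Rightarrow> nat) \<Rightarrow> real" where
  "spin_proposal n x y =
     (\<Sum>v\<in>{1..n}. \<Sum>s\<in>{1, 2, 3}. if x(v := s) = y then 1 / (3 * real n) else 0)"

definition metropolis ::
    "nat \<Rightarrow> ((nat \<Rightarrow> nat) \<Rightarrow> real) \<Rightarrow> (nat \<Rightarrow> nat) \<Rightarrow> (nat \<Rightarrow> nat) \<Rightarrow> real" where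
  "metropolis n \<rho> =
     chain_of_moves (potts_configs n) (\<lambda>x y. spin_proposal n x y * min 1 (\<rho> y / \<rho> x))"

definition tempering_states :: "nat \<Rightarrow> nat \<Rightarrow> ((nat \<Rightarrow> nat) \<times> nat) set" where
  "tempering_states n M = potts_configs n \<times> {0..M}"

text \<open>
  In each entry the first factor \<open>1 / 2\<close> is the choice between level and temperature move.
  The second one is the laziness of the level move, respectively the probability of choosing the
  neighbouring level. A neighbour outside of \<open>{0..M}\<close> contributes to staying put.
\<close>
definition tempering_chain ::
    "nat \<Rightarrow> nat \<Rightarrow> (nat \<Rightarrow> real) \<Rightarrow> (nat \<Rightarrow> nat) \<times> nat \<Rightarrow> (nat \<Rightarrow> nat) \<times> nat \<Rightarrow> real" where
  "tempering_chain n M \<beta> = chain_of_moves (tempering_states n M)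
     (\<lambda>(x, i) (y, j).
        if j = i then 1 / 2 * (1 / 2 * metropolis n (potts_gibbs n (\<beta> i)) x y)
        else if y = x \<and> (j = i + 1 \<or> i = j + 1)
        then 1 / 2 * (1 / 2 * min 1 (potts_gibbs n (\<beta> j) x / potts_gibbs n (\<beta> i) x))
        else 0)"

definition tempering_dist :: "nat \<Rightarrow> nat \<Rightarrow> (nat \<Rightarrow> real) \<Rightarrow> (nat \<Rightarrow> nat) \<times> nat \<Rightarrow> real" where
  "tempering_dist n M \<beta> = (\<lambda>(x, i). potts_gibbs n (\<beta> i) x / (real M + 1))"

text \<open>Sets of measure 0 are excluded, as the quotient is undefined (and 0 in HOL) for them.\<close>
definition conductance :: "'a set \<Rightarrow> ('a \<Rightarrow> real) \<Rightarrow> ('a \<Rightarrow> 'a \<Rightarrow> real) \<Rightarrow> real" where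
  "conductance X \<pi> P =
     Min ((\<lambda>S. (\<Sum>x\<in>S. \<Sum>y\<in>X - S. \<pi> x * P x y) / sum \<pi> S) `
          {S. S \<subseteq> X \<and> 0 < sum \<pi> S \<and> sum \<pi> S \<le> 1 / 2})"

end

theory Submission
  imports Defs "HOL-Analysis.Convex" "HOL-Combinatorics.Transposition"
begin

text \<open>
  The bottleneck set \<open>S\<close> consists of the configurations in which spin 1 has a strict majority, at
  every temperature. A level move can leave it only from a configuration with spin fractions near
  \<open>(1/2, u, 1/2 - u)\<close>. The exponential rate of such configurations, relative to the disordered
  state \<open>(1/3, 1/3, 1/3)\<close>, increases with \<open>\<beta>\<close>, so it is largest at \<open>\<beta>\<^sub>c\<close>; there it is attained
  at the saddle \<open>(1/2, 1/4, 1/4)\<close> and equals \<open>19/12 ln 2 - ln 3 < 0\<close>. Hence the boundary of \<open>S\<close>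
  is exponentially small at every temperature. At \<open>\<beta>\<^sub>c\<close> itself the disordered state and the
  ordered state \<open>(2/3, 1/6, 1/6)\<close> have the same rate, so \<open>S\<close> has at least inverse polynomial
  weight there, and inverse polynomial stationary weight as there are polynomially many levels.
\<close>

section \<open>Spin counts and their classes\<close>

definition spin_count :: "nat \<Rightarrow> nat \<Rightarrow> (nat \<Rightarrow> nat) \<Rightarrow> nat" where
  "spin_count n s x = card {v \<in> {1..n}. x v = s}"

definition potts_weight :: "nat \<Rightarrow> real \<Rightarrow> (nat \<Rightarrow> nat) set \<Rightarrow> real" where
  "potts_weight n \<beta> A = (\<Sum>x\<in>A. exp (\<beta> * real (potts_H n x)))"

lemma finite_potts_configs [simp]: "finite (potts_configs n)"
  by (simp add: potts_configs_def finite_PiE)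

lemma card_potts_configs: "card (potts_configs n) = 3 ^ n"
  by (simp add: potts_configs_def card_PiE numeral_3_eq_3)

lemma potts_configs_spin: "x \<in> potts_configs n \<Longrightarrow> v \<in> {1..n} \<Longrightarrow> x v \<in> {1, 2, 3}"
  unfolding potts_configs_def by (rule PiE_mem)

lemma spin_count_0 [simp]: "spin_count 0 s x = 0"
  by (simp add: spin_count_def)

lemma spin_count_Suc:
  "spin_count (Suc n) s x = spin_count n s x + (if x (Suc n) = s then 1 else 0)"
proof -
  have "{v \<in> {1..Suc n}. x v = s} =
      (if x (Suc n) = s then insert (Suc n) {v \<in> {1..n}. x v = s} else {v \<in> {1..n}. x v = s})"
    by (auto simp: le_Suc_eq)
  then show ?thesis by (simp add: spin_count_def)
qed

lemma spin_count_le: "spin_count n s x \<le> n"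
proof -
  have "card {v \<in> {1..n}. x v = s} \<le> card {1..n}" by (intro card_mono) auto
  then show ?thesis by (simp add: spin_count_def)
qed

lemma spin_count_total:
  assumes "x \<in> potts_configs n"
  shows "spin_count n 1 x + spin_count n 2 x + spin_count n 3 x = n"
proof -
  have "(\<forall>v\<in>{1..m}. x v \<in> {1, 2, 3}) \<Longrightarrow>
      spin_count m 1 x + spin_count m 2 x + spin_count m 3 x = m" for m
    by (induction m) (auto simp: spin_count_Suc)
  then show ?thesis using potts_configs_spin[OF assms] by blast
qed

lemma potts_H_Suc: "potts_H (Suc n) x = potts_H n x + spin_count n (x (Suc n)) x"
proof -
  have "{1..<Suc n} \<inter> {i. x i = x (Suc n)} = {v \<in> {1..n}. x v = x (Suc n)}" by auto
  then have "(\<Sum>i\<in>{1..<Suc n}. if x i = x (Suc n) then 1 else 0) = spin_count n (x (Suc n)) x"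
    by (subst sum.If_cases) (simp_all add: spin_count_def)
  then show ?thesis by (simp add: potts_H_def)
qed

text \<open>A spin with count \<open>c\<close> contributes \<open>c (c - 1) / 2\<close> equal pairs,
  and the counts add up to \<open>n\<close>. This form avoids subtraction and division on the
  naturals.\<close>

lemma potts_H_eq:
  assumes "x \<in> potts_configs n"
  shows "2 * potts_H n x + n =
    (spin_count n 1 x)\<^sup>2 + (spin_count n 2 x)\<^sup>2 + (spin_count n 3 x)\<^sup>2"
proof -
  have "(\<forall>v\<in>{1..m}. x v \<in> {1, 2, 3}) \<Longrightarrow> 2 * potts_H m x + m =
      (spin_count m 1 x)\<^sup>2 + (spin_count m 2 x)\<^sup>2 + (spin_count m 3 x)\<^sup>2" for m
  proof (induction m)
    case 0
    then show ?case by (simp add: potts_H_def)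
  next
    case (Suc m)
    then have "x (Suc m) \<in> {1, 2, 3}" by auto
    then show ?case using Suc
      by (auto simp: spin_count_Suc potts_H_Suc power2_eq_square)
  qed
  then show ?thesis using potts_configs_spin[OF assms] by blast
qed

lemma potts_H_real:
  assumes "x \<in> potts_configs n"
  shows "real (potts_H n x) = ((real (spin_count n 1 x))\<^sup>2 + (real (spin_count n 2 x))\<^sup>2
    + (real (spin_count n 3 x))\<^sup>2 - real n) / 2"
proof -
  have "real (2 * potts_H n x + n) = real ((spin_count n 1 x)\<^sup>2 + (spin_count n 2 x)\<^sup>2 + (spin_count n 3 x)\<^sup>2)"
    using potts_H_eq[OF assms] by presburger
  then show ?thesis by simp
qed

lemma spin_count_total_real:
  assumes "x \<in> potts_configs n"
  shows "real (spin_count n 3 x) = real n - real (spin_count n 1 x) - real (spin_count n 2 x)"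
  using spin_count_total[OF assms] by linarith

lemma prod_spins_eq:
  fixes q :: "nat \<Rightarrow> real"
  assumes "x \<in> potts_configs n"
  shows "(\<Prod>v\<in>{1..n}. q (x v)) =
    q 1 ^ spin_count n 1 x * q 2 ^ spin_count n 2 x * q 3 ^ spin_count n 3 x"
proof -
  have "(\<forall>v\<in>{1..m}. x v \<in> {1, 2, 3}) \<Longrightarrow> (\<Prod>v\<in>{1..m}. q (x v)) =
      q 1 ^ spin_count m 1 x * q 2 ^ spin_count m 2 x * q 3 ^ spin_count m 3 x" for m
  proof (induction m)
    case (Suc m)
    then have "x (Suc m) \<in> {1, 2, 3}" by auto
    then show ?case using Suc by (auto simp: spin_count_Suc)
  qed simp
  then show ?thesis using potts_configs_spin[OF assms] by blast
qed

text \<open>The multinomial theorem, from expanding a product over sites. It normalises product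
  measures in the class bounds and later evaluates sums of \<open>4 ^ spin_count\<close> and
  \<open>2 ^ spin_count\<close>.\<close>

lemma sum_spin_weights:
  fixes q :: "nat \<Rightarrow> real"
  shows "(\<Sum>x\<in>potts_configs n. q 1 ^ spin_count n 1 x * q 2 ^ spin_count n 2 x * q 3 ^ spin_count n 3 x)
    = (q 1 + q 2 + q 3) ^ n"
proof -
  have "(\<Sum>x\<in>potts_configs n. q 1 ^ spin_count n 1 x * q 2 ^ spin_count n 2 x * q 3 ^ spin_count n 3 x)
      = (\<Sum>x\<in>potts_configs n. \<Prod>v\<in>{1..n}. q (x v))"
    by (intro sum.cong refl prod_spins_eq[symmetric])
  also have "\<dots> = (\<Prod>v\<in>{1..n}. \<Sum>s\<in>{1, 2, 3}. q s)"
    unfolding potts_configs_def by (rule prod_sum_PiE[symmetric]) auto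
  also have "\<dots> = (q 1 + q 2 + q 3) ^ n" by (simp add: add.assoc)
  finally show ?thesis .
qed

section \<open>The partition function\<close>

lemma potts_Z_pos: "0 < potts_Z n \<beta>"
  unfolding potts_Z_def
proof (rule sum_pos)
  show "potts_configs n \<noteq> {}"
    using card_potts_configs[of n] by auto
qed auto

lemma potts_weight_nonneg: "0 \<le> potts_weight n \<beta> A"
  unfolding potts_weight_def by (intro sum_nonneg) auto

lemma sum_potts_gibbs: "sum (potts_gibbs n \<beta>) A = potts_weight n \<beta> A / potts_Z n \<beta>"
  unfolding potts_gibbs_def potts_weight_def by (simp add: sum_divide_distrib)

lemma sum_squares_ge_third: "((a::real) + b + c)\<^sup>2 / 3 \<le> a\<^sup>2 + b\<^sup>2 + c\<^sup>2"
proof -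
  have "3 * (a\<^sup>2 + b\<^sup>2 + c\<^sup>2) - (a + b + c)\<^sup>2 = (a - b)\<^sup>2 + (a - c)\<^sup>2 + (b - c)\<^sup>2"
    by algebra
  moreover have "0 \<le> (a - b)\<^sup>2 + (a - c)\<^sup>2 + (b - c)\<^sup>2" by simp
  ultimately have "(a + b + c)\<^sup>2 \<le> 3 * (a\<^sup>2 + b\<^sup>2 + c\<^sup>2)" by linarith
  then show ?thesis by simp
qed

text \<open>Equal counts minimise the energy, so each of the \<open>3 ^ n\<close> configurations
  weighs at least as much as a disordered one. The result has the exponential rate of the disordered
  state.\<close>

lemma potts_Z_ge:
  assumes "0 \<le> \<beta>"
  shows "exp (real n * ln 3 + \<beta> * ((real n)\<^sup>2 / 3 - real n) / 2) \<le> potts_Z n \<beta>"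
proof -
  have "exp (\<beta> * ((real n)\<^sup>2 / 3 - real n) / 2) \<le> exp (\<beta> * real (potts_H n x))"
    if x: "x \<in> potts_configs n" for x
  proof -
    have "(real n)\<^sup>2 / 3 - real n \<le> 2 * real (potts_H n x)"
      using sum_squares_ge_third[of "real (spin_count n 1 x)" "real (spin_count n 2 x)" "real (spin_count n 3 x)"]
      unfolding potts_H_real[OF x] by (simp add: spin_count_total_real[OF x])
    from mult_left_mono[OF this assms] show ?thesis by simp
  qed
  then have "real (card (potts_configs n)) * exp (\<beta> * ((real n)\<^sup>2 / 3 - real n) / 2) \<le> potts_Z n \<beta>"
    unfolding potts_Z_def by (intro sum_bounded_below) auto
  moreover have "real (card (potts_configs n)) = exp (real n * ln 3)"
    by (simp add: card_potts_configs exp_of_nat_mult)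
  ultimately show ?thesis by (simp add: exp_add)
qed

section \<open>Size and weight of a spin class\<close>

text \<open>For \<open>x \<ge> 0\<close> the derivative of
  \<open>exp (- x\<^sup>2 / 2) * cosh x\<close> has the sign of \<open>sinh x - x * cosh x\<close>,
  which is nonpositive; evenness gives the rest. The bound makes the entropy cost of an imbalance
  between spins 2 and 3 quadratic, hence comparable with the energy.\<close>

lemma cosh_le_exp_half_square: "cosh x \<le> exp (x\<^sup>2 / 2)" for x :: real
proof -
  have main: "cosh x \<le> exp (x\<^sup>2 / 2)" if "0 \<le> x" for x :: real
  proof -
    have s: "sinh y \<le> y * cosh y" if "0 \<le> y" for y :: real
    proof -
      have "0 * cosh 0 - sinh 0 \<le> y * cosh y - sinh (y::real)"
      proof (rule DERIV_nonneg_imp_nondecreasing[OF that])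
        fix t :: real assume t: "0 \<le> t" "t \<le> y"
        have "((\<lambda>t. t * cosh t - sinh t) has_real_derivative t * sinh t) (at t)"
          by (auto intro!: derivative_eq_intros)
        then show "\<exists>D. ((\<lambda>t. t * cosh t - sinh t) has_real_derivative D) (at t) \<and> 0 \<le> D"
          using t by (auto intro!: exI[of _ "t * sinh t"])
      qed
      then show ?thesis by simp
    qed
    have "exp (- (x\<^sup>2 / 2)) * cosh x \<le> exp (- (0\<^sup>2 / 2)) * cosh 0"
    proof (rule DERIV_nonpos_imp_nonincreasing[OF that])
      fix t :: real assume t: "0 \<le> t" "t \<le> x"
      have "((\<lambda>t. exp (- (t\<^sup>2 / 2)) * cosh t) has_real_derivative
          exp (- (t\<^sup>2 / 2)) * (sinh t - t * cosh t)) (at t)"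
        by (auto intro!: derivative_eq_intros simp: algebra_simps)
      moreover have "exp (- (t\<^sup>2 / 2)) * (sinh t - t * cosh t) \<le> 0"
        using s[OF t(1)] by (intro mult_nonneg_nonpos) auto
      ultimately show "\<exists>D. ((\<lambda>t. exp (- (t\<^sup>2 / 2)) * cosh t) has_real_derivative D) (at t) \<and> D \<le> 0"
        by blast
    qed
    then show ?thesis by (simp add: exp_minus field_simps)
  qed
  show ?thesis using main[of x] main[of "-x"] by (cases "0 \<le> x") auto
qed

definition spin_class :: "nat \<Rightarrow> nat \<Rightarrow> nat \<Rightarrow> (nat \<Rightarrow> nat) set" where
  "spin_class n a b = {x \<in> potts_configs n. spin_count n 1 x = a \<and> spin_count n 2 x = b}"

text \<open>
  The class has probability at most 1 under the product measure that gives spin 1 the probability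
  \<open>p\<close> and tilts spins 2 and 3 by \<open>exp l\<close> and \<open>exp (- l)\<close>, with \<open>l\<close> optimal for the bound
  \<open>cosh l \<le> exp (l\<^sup>2 / 2)\<close>.
\<close>
lemma card_spin_class_le:
  fixes p :: real
  assumes p: "0 < p" "p < 1" and ab: "a + b \<le> n" "a < n"
  shows "real (card (spin_class n a b)) \<le>
    exp (- real a * ln p - (real n - real a) * ln ((1 - p) / 2)
         - (2 * real b + real a - real n)\<^sup>2 / (2 * (real n - real a)))"
proof -
  define m where "m = n - a"
  define c where "c = n - a - b"
  define d where "d = real b - real c"
  define l where "l = d / real m"
  define q where "q = (\<lambda>s::nat. if s = 1 then p else if s = 2 then (1 - p) * exp l / (2 * cosh l)
                              else (1 - p) * exp (- l) / (2 * cosh l))"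
  have m: "m > 0" "m = b + c" "real m = real n - real a" "d = 2 * real b + real a - real n"
    using ab by (auto simp: m_def c_def d_def)
  have "0 < real m" using m(1) by simp
  have cpos: "cosh l > 0" by simp
  have q0: "0 < q s" for s using p cpos by (auto simp: q_def)
  have ch: "exp l + exp (- l) = 2 * cosh l" by (simp add: cosh_def)
  have "q 1 + q 2 + q 3 = p + (1 - p) * (exp l + exp (- l)) / (2 * cosh l)"
    by (simp add: q_def add_divide_distrib distrib_left)
  also have "\<dots> = 1" unfolding ch using cpos by simp
  finally have q1: "q 1 + q 2 + q 3 = 1" .
  have cnt: "spin_count n 3 x = c" if "x \<in> spin_class n a b" for x
    using that spin_count_total[of x n] by (auto simp: spin_class_def c_def)
  have "real (card (spin_class n a b)) * (q 1 ^ a * q 2 ^ b * q 3 ^ c) =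
      (\<Sum>x\<in>spin_class n a b. q 1 ^ spin_count n 1 x * q 2 ^ spin_count n 2 x * q 3 ^ spin_count n 3 x)"
    using cnt by (simp add: spin_class_def)
  also have "\<dots> \<le> (\<Sum>x\<in>potts_configs n. q 1 ^ spin_count n 1 x * q 2 ^ spin_count n 2 x * q 3 ^ spin_count n 3 x)"
    using q0 by (intro sum_mono2) (auto simp: spin_class_def less_imp_le)
  also have "\<dots> = 1" unfolding sum_spin_weights q1 by simp
  finally have le1: "real (card (spin_class n a b)) * (q 1 ^ a * q 2 ^ b * q 3 ^ c) \<le> 1" .
  have pw: "t ^ k = exp (real k * ln t)" if "0 < t" for t k
    using that by (simp add: exp_of_nat_mult)
  have lnc: "ln (cosh l) \<le> l\<^sup>2 / 2"
    using cosh_le_exp_half_square[of l] cpos by (metis ln_exp ln_le_cancel_iff exp_gt_zero)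
  have l2: "ln (q 2) = ln ((1 - p) / 2) + l - ln (cosh l)"
    and l3: "ln (q 3) = ln ((1 - p) / 2) - l - ln (cosh l)"
    using p cpos by (simp_all add: q_def ln_mult ln_div)
  have "q 1 ^ a * q 2 ^ b * q 3 ^ c = exp (real a * ln p + real b * ln (q 2) + real c * ln (q 3))"
    using q0[of 1] q0[of 2] q0[of 3] p by (simp add: pw exp_add) (simp add: q_def)
  also have "\<dots> = exp (real a * ln p + real m * ln ((1 - p) / 2) + d * l - real m * ln (cosh l))"
    unfolding l2 l3 d_def m(2) by (simp add: algebra_simps)
  also have "\<dots> \<ge> exp (real a * ln p + real m * ln ((1 - p) / 2) + d * l - real m * (l\<^sup>2 / 2))"
    using lnc m by (auto intro!: mult_left_mono)
  finally have ge: "exp (real a * ln p + real m * ln ((1 - p) / 2) + d * l - real m * (l\<^sup>2 / 2))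
      \<le> q 1 ^ a * q 2 ^ b * q 3 ^ c" .
  have dl: "d * l - real m * (l\<^sup>2 / 2) = d\<^sup>2 / (2 * real m)"
    unfolding l_def using \<open>0 < real m\<close> by (simp add: field_simps power2_eq_square)
  define E where "E = real a * ln p + real m * ln ((1 - p) / 2) + d\<^sup>2 / (2 * real m)"
  have "real (card (spin_class n a b)) * exp E \<le> 1"
    using order_trans[OF mult_left_mono[OF ge] le1] dl by (simp add: E_def add_diff_eq[symmetric])
  then have "real (card (spin_class n a b)) \<le> exp (- E)"
    by (simp add: exp_minus field_simps)
  also have "- E = - real a * ln p - (real n - real a) * ln ((1 - p) / 2)
         - (2 * real b + real a - real n)\<^sup>2 / (2 * (real n - real a))"
    unfolding E_def m(3,4) by simp
  finally show ?thesis .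
qed

text \<open>With \<open>c = n - a - b\<close>, the sum \<open>b\<^sup>2 + c\<^sup>2\<close> is half
  of \<open>(b + c)\<^sup>2 + (b - c)\<^sup>2\<close>. The imbalance
  \<open>b - c = 2 b + a - n\<close> then enters by its square, as in
  \<open>card_spin_class_le\<close>.\<close>

lemma potts_H_spin_class:
  assumes "x \<in> spin_class n a b"
  shows "real (potts_H n x) = ((real a)\<^sup>2 + (real n - real a)\<^sup>2 / 2
     + (2 * real b + real a - real n)\<^sup>2 / 2 - real n) / 2"
proof -
  have x: "x \<in> potts_configs n" "spin_count n 1 x = a" "spin_count n 2 x = b"
    using assms by (auto simp: spin_class_def)
  show ?thesis unfolding potts_H_real[OF x(1)] spin_count_total_real[OF x(1)] x(2,3)
    by (simp add: power2_eq_square field_simps)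
qed

text \<open>The parameter \<open>p\<close> stays free: it will be \<open>1 / 2\<close> at the
  boundary of the bottleneck set and \<open>a / n\<close> for counts between \<open>n / 3\<close>
  and \<open>n / 2\<close>.\<close>

lemma potts_weight_spin_class_le:
  fixes p \<beta> :: real
  assumes p: "0 < p" "p < 1" and ab: "a + b \<le> n" "a < n"
  shows "potts_weight n \<beta> (spin_class n a b) \<le>
    exp (- real a * ln p - (real n - real a) * ln ((1 - p) / 2)
         - (2 * real b + real a - real n)\<^sup>2 / (2 * (real n - real a))
         + \<beta> * (((real a)\<^sup>2 + (real n - real a)\<^sup>2 / 2
     + (2 * real b + real a - real n)\<^sup>2 / 2 - real n) / 2))"
proof -
  have "potts_weight n \<beta> (spin_class n a b) = real (card (spin_class n a b)) *
      exp (\<beta> * (((real a)\<^sup>2 + (real n - real a)\<^sup>2 / 2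
     + (2 * real b + real a - real n)\<^sup>2 / 2 - real n) / 2))"
    unfolding potts_weight_def by (simp add: potts_H_spin_class)
  also have "\<dots> \<le> exp (- real a * ln p - (real n - real a) * ln ((1 - p) / 2)
         - (2 * real b + real a - real n)\<^sup>2 / (2 * (real n - real a))) *
      exp (\<beta> * (((real a)\<^sup>2 + (real n - real a)\<^sup>2 / 2
     + (2 * real b + real a - real n)\<^sup>2 / 2 - real n) / 2))"
    by (intro mult_right_mono card_spin_class_le assms) auto
  finally show ?thesis by (simp add: exp_add)
qed

text \<open>There are at most \<open>(n + 1)\<^sup>2\<close> classes, a polynomial factor that is
  harmless on the exponential scale.\<close>

lemma potts_weight_le_classes:
  assumes "\<And>a b. a + b \<le> n \<Longrightarrow> P a \<Longrightarrow> potts_weight n \<beta> (spin_class n a b) \<le> C" and "0 \<le> C"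
  shows "potts_weight n \<beta> {x \<in> potts_configs n. P (spin_count n 1 x)} \<le> (real n + 1)\<^sup>2 * C"
proof -
  let ?A = "{x \<in> potts_configs n. P (spin_count n 1 x)}"
  let ?g = "\<lambda>x. (spin_count n 1 x, spin_count n 2 x)"
  let ?T = "{..n} \<times> {..n}"
  have "potts_weight n \<beta> ?A = (\<Sum>t\<in>?T. potts_weight n \<beta> {x \<in> ?A. ?g x = t})"
    unfolding potts_weight_def by (rule sum.group[symmetric]) (auto simp: spin_count_le)
  also have "\<dots> \<le> real (card ?T) * C"
  proof (rule sum_bounded_above)
    fix t assume "t \<in> ?T"
    obtain a b where t: "t = (a, b)" by (cases t)
    show "potts_weight n \<beta> {x \<in> ?A. ?g x = t} \<le> C"
    proof (cases "{x \<in> ?A. ?g x = t} = {}")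
      case True
      show ?thesis unfolding True using assms(2) by (simp add: potts_weight_def)
    next
      case False
      then obtain x where x: "x \<in> potts_configs n" "P a" "spin_count n 1 x = a" "spin_count n 2 x = b"
        unfolding t by auto
      have "{x \<in> ?A. ?g x = t} = spin_class n a b"
        using x by (auto simp: t spin_class_def)
      then show ?thesis using assms(1)[of a b] x spin_count_total[OF x(1)] by simp
    qed
  qed
  also have "real (card ?T) = (real n + 1)\<^sup>2"
    by (simp add: power2_eq_square algebra_simps)
  finally show ?thesis .
qed

section \<open>Weights at and below the critical temperature\<close>

text \<open>Ensures that at the critical temperature an imbalance between spins 2 and 3 costs at
  least as much entropy as it gains energy, as long as spin 1 has at least a third of the
  sites.\<close>

lemma ln_2_le: "ln 2 \<le> (3 / 4 :: real)"
proof -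
  have "(2::real) \<le> 1 + 3 / 4 + (3 / 4)\<^sup>2 / 2" by (simp add: power2_eq_square)
  also have "\<dots> \<le> exp (3 / 4)" by (rule exp_lower_Taylor_quadratic) simp
  finally show ?thesis by (metis ln_exp ln_le_cancel_iff exp_gt_zero zero_less_numeral)
qed

text \<open>Convexity of the difference, which vanishes at \<open>1/3\<close> and at \<open>1/2\<close>.\<close>
lemma logit_le:
  assumes "1 / 3 \<le> p" "p \<le> (1 / 2 :: real)"
  shows "ln (1 - p) - ln p \<le> 3 * ln 2 * (1 - 2 * p)"
proof -
  define f where "f = (\<lambda>p::real. ln (1 - p) - ln p - 3 * ln 2 * (1 - 2 * p))"
  have cv: "convex_on {1 / 3..1 / 2} f"
  proof (rule f''_ge0_imp_convex)
    fix x :: real assume x: "x \<in> {1 / 3..1 / 2}"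
    show "DERIV f x :> - (1 / (1 - x)) - 1 / x + 6 * ln 2"
      unfolding f_def using x by (auto intro!: derivative_eq_intros simp: field_simps)
    show "DERIV (\<lambda>x. - (1 / (1 - x)) - 1 / x + 6 * ln 2) x :> 1 / x\<^sup>2 - 1 / (1 - x)\<^sup>2"
      using x by (auto intro!: derivative_eq_intros simp: power2_eq_square)
    have "x\<^sup>2 \<le> (1 - x)\<^sup>2" using x by (intro power_mono) auto
    then show "0 \<le> 1 / x\<^sup>2 - 1 / (1 - x)\<^sup>2" using x by (simp add: frac_le)
  qed simp
  have "f (1 / 3) = ln (2 / 3) - ln (1 / 3) - ln 2" by (simp add: f_def)
  also have "\<dots> = 0" by (simp add: ln_div)
  finally have f3: "f (1 / 3) = 0" .
  have f2: "f (1 / 2) = 0" by (simp add: f_def)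
  define t where "t = 6 * p - 2"
  have "f ((1 - t) *\<^sub>R (1 / 3) + t *\<^sub>R (1 / 2)) \<le> (1 - t) * f (1 / 3) + t * f (1 / 2)"
    using assms by (intro convex_onD[OF cv]) (auto simp: t_def)
  moreover have "(1 - t) *\<^sub>R (1 / 3) + t *\<^sub>R (1 / 2) = p" by (simp add: t_def field_simps)
  ultimately have "f p \<le> 0" by (simp add: f2 f3)
  then show ?thesis by (simp add: f_def)
qed

text \<open>By \<open>logit_le\<close> the difference of the two sides is monotone in
  \<open>p\<close>, and they agree at \<open>1 / 3\<close>. The quadratic is chosen to cancel the
  critical energy.\<close>

lemma binary_entropy_le:
  assumes "1 / 3 \<le> p" "p \<le> (1 / 2 :: real)"
  shows "- p * ln p - (1 - p) * ln (1 - p) \<le> ln 3 - 4 / 3 * ln 2 + 3 * ln 2 * p * (1 - p)"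
proof -
  define g where "g = (\<lambda>p::real. - p * ln p - (1 - p) * ln (1 - p) - 3 * ln 2 * p * (1 - p))"
  have "g p \<le> g (1 / 3)"
  proof (rule DERIV_nonpos_imp_nonincreasing[OF assms(1)])
    fix x :: real assume x: "1 / 3 \<le> x" "x \<le> p"
    have "DERIV g x :> ln (1 - x) - ln x - 3 * ln 2 * (1 - 2 * x)"
      unfolding g_def using x assms
      by (auto intro!: derivative_eq_intros simp: right_diff_distrib)
         (simp add: field_simps)
    then show "\<exists>D. DERIV g x :> D \<and> D \<le> 0"
      using logit_le[of x] x assms by fastforce
  qed
  moreover have "g (1 / 3) = ln 3 - 4 / 3 * ln 2"
    by (simp add: g_def ln_div field_simps)
  ultimately show ?thesis by (simp add: g_def)
qed

section \<open>Boundary, intermediate and ordered weights\<close>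

text \<open>The class bound with \<open>p = 1 / 2\<close> is divided by the disordered bound on
  \<open>potts_Z\<close>. The saddle contributes \<open>3/2 ln 2\<close> of entropy and, at the
  critical temperature, \<open>1/12 ln 2\<close> of energy excess over the disordered state.\<close>

lemma sum_gibbs_boundary_le:
  assumes \<beta>: "0 \<le> \<beta>" "\<beta> \<le> 4 * ln 2 / real n" and n: "3 \<le> n"
  shows "sum (potts_gibbs n \<beta>) {x \<in> potts_configs n. n < 2 * spin_count n 1 x \<and> 2 * spin_count n 1 x \<le> n + 2}
    \<le> (real n + 1)\<^sup>2 * exp (3 * ln 2 - real n * (ln 3 - 19 / 12 * ln 2))"
proof -
  let ?C = "exp (3 * ln 2 - real n * (ln 3 - 19 / 12 * ln 2))"
  have "potts_weight n \<beta> {x \<in> potts_configs n. n < 2 * spin_count n 1 x \<and> 2 * spin_count n 1 x \<le> n + 2}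
      \<le> (real n + 1)\<^sup>2 * (?C * potts_Z n \<beta>)"
  proof (rule potts_weight_le_classes)
    fix a b assume ab: "a + b \<le> n" "n < 2 * a \<and> 2 * a \<le> n + 2"
    define A N where "A = real a" and "N = real n"
    define D where "D = (2 * real b + A - N)\<^sup>2"
    define Q where "Q = A\<^sup>2 + (N - A)\<^sup>2 / 2 + D / 2 - N\<^sup>2 / 3"
    have a: "a < n" "N < 2 * A" "2 * A \<le> N + 2" "3 \<le> N" "A < N" using ab n by (auto simp: A_def N_def)
    have D0: "0 \<le> D" by (simp add: D_def)
    have "Q \<ge> 0"
      using sum_squares_ge_third[of A "real b" "N - A - real b"]
      unfolding Q_def D_def by (simp add: power2_eq_square field_simps)
    \<comment> \<open>After division by the disordered weight the bound is monotone in \<open>\<beta>\<close>, as \<open>Q \<ge> 0\<close>.\<close>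
    then have "\<beta> / 2 * Q \<le> (2 * ln 2 / N) * Q"
      using \<beta> by (intro mult_right_mono) (auto simp: N_def)
    moreover have "(2 * ln 2 / N) * Q = ln 2 * ((2 * A\<^sup>2 + (N - A)\<^sup>2 - 2 * N\<^sup>2 / 3) / N) + D * (ln 2 / N)"
      using a by (simp add: Q_def field_simps)
    \<comment> \<open>Balanced spins 2 and 3 are the worst case: the entropy loss from
      \<open>D\<close> outweighs its energy gain.\<close>
    moreover have "D * (ln 2 / N) \<le> D / (2 * (N - A))"
    proof -
      have "ln 2 * (2 * (N - A)) \<le> 1 * N" using a ln_2_le by (intro mult_mono) auto
      then have "ln 2 / N \<le> 1 / (2 * (N - A))" using a by (simp add: field_simps)
      from mult_left_mono[OF this D0] show ?thesis by simp
    qed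
    \<comment> \<open>The left side is \<open>19/12 N + 3 (2 A - N)\<^sup>2 / (4 N)\<close>; the
      linear term in \<open>2 A - N\<close> cancels because the saddle is a critical point.\<close>
    moreover have "(A + 2 * (N - A)) + (2 * A\<^sup>2 + (N - A)\<^sup>2 - 2 * N\<^sup>2 / 3) / N \<le> 3 + 19 / 12 * N"
    proof -
      have "(2 * A - N)\<^sup>2 \<le> 2\<^sup>2" using a by (intro power_mono) auto
      then have "9 * (2 * A - N)\<^sup>2 \<le> 36 * N" using a by simp
      then show ?thesis using a by (simp add: field_simps power2_eq_square)
    qed
    then have "ln 2 * ((A + 2 * (N - A)) + (2 * A\<^sup>2 + (N - A)\<^sup>2 - 2 * N\<^sup>2 / 3) / N) \<le> ln 2 * (3 + 19 / 12 * N)"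
      by (intro mult_left_mono) auto
    ultimately have key: "ln 2 * (A + 2 * (N - A)) - D / (2 * (N - A)) + \<beta> / 2 * Q \<le> ln 2 * (3 + 19 / 12 * N)"
      unfolding distrib_left by linarith
    have "potts_weight n \<beta> (spin_class n a b) \<le> exp (- A * ln (1 / 2) - (N - A) * ln ((1 - 1 / 2) / 2)
         - D / (2 * (N - A)) + \<beta> * ((A\<^sup>2 + (N - A)\<^sup>2 / 2 + D / 2 - N) / 2))"
      unfolding A_def N_def D_def by (rule potts_weight_spin_class_le) (use ab a in auto)
    also have "\<dots> = exp (ln 2 * (A + 2 * (N - A)) - D / (2 * (N - A)) + \<beta> / 2 * Q + \<beta> * (N\<^sup>2 / 3 - N) / 2)"
    proof -
      have "ln (4::real) = 2 * ln 2" using ln_realpow[of 2 2] by simp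
      then show ?thesis by (simp add: ln_div Q_def field_simps)
    qed
    also have "\<dots> \<le> exp (ln 2 * (3 + 19 / 12 * N) + \<beta> * (N\<^sup>2 / 3 - N) / 2)" using key by simp
    also have "\<dots> = ?C * exp (N * ln 3 + \<beta> * (N\<^sup>2 / 3 - N) / 2)"
      unfolding exp_add[symmetric] N_def[symmetric] by (simp add: algebra_simps)
    also have "\<dots> \<le> ?C * potts_Z n \<beta>"
      using potts_Z_ge[OF \<beta>(1), of n] by (simp add: N_def)
    finally show "potts_weight n \<beta> (spin_class n a b) \<le> ?C * potts_Z n \<beta>" .
  qed (use potts_Z_pos[of n \<beta>] in simp)
  then show ?thesis unfolding sum_potts_gibbs
    using potts_Z_pos[of n \<beta>] by (simp add: field_simps)
qed

text \<open>With \<open>p = a / n\<close>, the bound \<open>binary_entropy_le\<close> turns the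
  entropy into a quadratic that cancels the energy, so one bound, with the rate of the disordered
  state, covers the whole range. The \<open>- 2\<close> comes from the term \<open>- n / 2\<close>
  of the energy.\<close>

lemma potts_weight_disordered_le:
  assumes n: "3 \<le> n"
  shows "potts_weight n (4 * ln 2 / real n) {x \<in> potts_configs n. n \<le> 3 * spin_count n 1 x \<and> 2 * spin_count n 1 x \<le> n}
    \<le> (real n + 1)\<^sup>2 * exp (real n * ln 3 + (2 / 3 * real n - 2) * ln 2)"
proof (rule potts_weight_le_classes)
  fix a b assume ab: "a + b \<le> n" "n \<le> 3 * a \<and> 2 * a \<le> n"
  define A N where "A = real a" and "N = real n"
  define D where "D = (2 * real b + A - N)\<^sup>2"
  define p where "p = A / N"
  have a: "a < n" "N \<le> 3 * A" "2 * A \<le> N" "3 \<le> N" "A < N" "0 < A"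
    using ab n by (auto simp: A_def N_def)
  have p: "1 / 3 \<le> p" "p \<le> 1 / 2" "A = N * p" using a by (auto simp: p_def field_simps)
  have D0: "0 \<le> D" by (simp add: D_def)
  have D: "D * (ln 2 / N) \<le> D / (2 * (N - A))"
  proof -
    \<comment> \<open>From \<open>N \<le> 3 * A\<close>, the factor \<open>2 * (N - A)\<close> is at
      most \<open>4 / 3 * N\<close>, which \<open>ln 2 \<le> 3 / 4\<close> exactly
      compensates.\<close>
    have "ln 2 * (2 * (N - A)) \<le> 3 / 4 * (4 / 3 * N)"
      using a ln_2_le by (intro mult_mono[of "ln 2"]) auto
    then have "ln 2 / N \<le> 1 / (2 * (N - A))" using a by (simp add: field_simps)
    from mult_left_mono[OF this D0] show ?thesis by simp
  qed
  have "N * (- p * ln p - (1 - p) * ln (1 - p)) \<le> N * (ln 3 - 4 / 3 * ln 2 + 3 * ln 2 * p * (1 - p))"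
    using binary_entropy_le[OF p(1,2)] a by (intro mult_left_mono) auto
  moreover have "- A * ln p - (N - A) * ln ((1 - p) / 2) =
      N * (- p * ln p - (1 - p) * ln (1 - p)) + N * (1 - p) * ln 2"
    using p by (simp add: ln_div algebra_simps)
  moreover have "4 * ln 2 / N * ((A\<^sup>2 + (N - A)\<^sup>2 / 2 + D / 2 - N) / 2) =
      N * ln 2 * (2 * p\<^sup>2 + (1 - p)\<^sup>2) - 2 * ln 2 + D * (ln 2 / N)"
    using a unfolding p(3) by (simp add: field_simps power2_eq_square)
  \<comment> \<open>All terms in \<open>p\<close> cancel:
    \<open>3 p (1 - p) + (1 - p) + 2 p\<^sup>2 + (1 - p)\<^sup>2 = 2\<close>.\<close>
  moreover have "N * (ln 3 - 4 / 3 * ln 2 + 3 * ln 2 * p * (1 - p)) + N * (1 - p) * ln 2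
      + (N * ln 2 * (2 * p\<^sup>2 + (1 - p)\<^sup>2) - 2 * ln 2) = N * ln 3 + (2 / 3 * N - 2) * ln 2"
    by (simp add: field_simps power2_eq_square)
  ultimately have key: "- A * ln p - (N - A) * ln ((1 - p) / 2) - D / (2 * (N - A))
      + 4 * ln 2 / N * ((A\<^sup>2 + (N - A)\<^sup>2 / 2 + D / 2 - N) / 2) \<le> N * ln 3 + (2 / 3 * N - 2) * ln 2"
    using D by linarith
  have "potts_weight n (4 * ln 2 / N) (spin_class n a b) \<le> exp (- A * ln p - (N - A) * ln ((1 - p) / 2)
       - D / (2 * (N - A)) + 4 * ln 2 / N * ((A\<^sup>2 + (N - A)\<^sup>2 / 2 + D / 2 - N) / 2))"
    unfolding A_def N_def D_def by (rule potts_weight_spin_class_le) (use ab a p in auto)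
  also have "\<dots> \<le> exp (N * ln 3 + (2 / 3 * N - 2) * ln 2)" using key by simp
  finally show "potts_weight n (4 * ln 2 / real n) (spin_class n a b)
      \<le> exp (real n * ln 3 + (2 / 3 * real n - 2) * ln 2)" unfolding N_def .
qed simp

text \<open>A tangent plane bounds each weight below by a multiple of
  \<open>4 ^ spin_count n 1 x\<close>. These powers sum to \<open>6 ^ n\<close>, and the
  configurations without a majority of spin 1 carry at most half of that by a Chernoff bound and
  \<open>big\<close>.\<close>

lemma potts_weight_ordered_ge:
  assumes n: "0 < n" and big: "2 * (4 * sqrt 2) ^ n \<le> (6::real) ^ n"
  shows "exp (real n * ln 3 + (2 / 3 * real n - 2) * ln 2) / 2 \<le>
    potts_weight n (4 * ln 2 / real n) {x \<in> potts_configs n. n < 2 * spin_count n 1 x}"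
proof -
  let ?S = "{x \<in> potts_configs n. n < 2 * spin_count n 1 x}"
  let ?T = "{x \<in> potts_configs n. \<not> n < 2 * spin_count n 1 x}"
  have pt: "exp (- (real n / 3 + 2) * ln 2) * 4 ^ spin_count n 1 x \<le> exp (4 * ln 2 / real n * real (potts_H n x))"
    if x: "x \<in> potts_configs n" for x
  proof -
    define a b N where "a = real (spin_count n 1 x)" and "b = real (spin_count n 2 x)" and "N = real n"
    have N: "0 < N" using n by (simp add: N_def)
    \<comment> \<open>Tangent plane of the convex energy at the ordered state \<open>(2/3, 1/6, 1/6)\<close>.\<close>
    have "0 \<le> (3 * a - 2 * N)\<^sup>2 / 6 + (2 * b - (N - a))\<^sup>2 / 2" by simp
    also have "\<dots> = a\<^sup>2 + b\<^sup>2 + (N - a - b)\<^sup>2 - N * a + N\<^sup>2 / 6"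
      by (simp add: power2_eq_square field_simps)
    finally have "a - N / 6 - 1 \<le> (a\<^sup>2 + b\<^sup>2 + (N - a - b)\<^sup>2 - N) / N"
      using N by (simp add: field_simps power2_eq_square)
    then have "2 * ln 2 * (a - N / 6 - 1) \<le> 2 * ln 2 * ((a\<^sup>2 + b\<^sup>2 + (N - a - b)\<^sup>2 - N) / N)"
      by (intro mult_left_mono) auto
    also have "\<dots> = 4 * ln 2 / real n * real (potts_H n x)"
      unfolding potts_H_real[OF x] spin_count_total_real[OF x] a_def[symmetric] b_def[symmetric] N_def[symmetric]
      by simp
    finally have "exp (2 * ln 2 * (a - N / 6 - 1)) \<le> exp (4 * ln 2 / real n * real (potts_H n x))" by simp
    moreover have "exp (2 * ln 2 * (a - N / 6 - 1)) = exp (- (real n / 3 + 2) * ln 2) * 4 ^ spin_count n 1 x"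
    proof -
      have "ln (4::real) = 2 * ln 2" using ln_realpow[of 2 2] by simp
      moreover have "(4::real) ^ spin_count n 1 x = exp (a * ln 4)" by (simp add: a_def exp_of_nat_mult)
      ultimately show ?thesis by (simp add: exp_add[symmetric] N_def algebra_simps)
    qed
    ultimately show ?thesis by simp
  qed
  \<comment> \<open>Chernoff bound: without a majority, one of the two factors
    \<open>2 ^ spin_count n 1 x\<close> is at most \<open>sqrt 2 ^ n\<close>.\<close>
  have "(\<Sum>x\<in>?T. 4 ^ spin_count n 1 x) \<le> (\<Sum>x\<in>?T. sqrt 2 ^ n * 2 ^ spin_count n 1 x)"
  proof (rule sum_mono)
    fix x assume x: "x \<in> ?T"
    have "(2::real) ^ spin_count n 1 x = sqrt 2 ^ (2 * spin_count n 1 x)" by (simp add: power_mult)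
    also have "\<dots> \<le> sqrt 2 ^ n" using x by (intro power_increasing) auto
    finally have "(2::real) ^ spin_count n 1 x * 2 ^ spin_count n 1 x \<le> sqrt 2 ^ n * 2 ^ spin_count n 1 x"
      by (intro mult_right_mono) auto
    then show "(4::real) ^ spin_count n 1 x \<le> sqrt 2 ^ n * 2 ^ spin_count n 1 x"
      by (simp add: power_mult_distrib[symmetric])
  qed
  also have "\<dots> \<le> (\<Sum>x\<in>potts_configs n. sqrt 2 ^ n * 2 ^ spin_count n 1 x)"
    by (intro sum_mono2) auto
  also have "\<dots> = sqrt 2 ^ n * (\<Sum>x\<in>potts_configs n. 2 ^ spin_count n 1 x)"
    by (simp add: sum_distrib_left)
  also have "(\<Sum>x\<in>potts_configs n. (2::real) ^ spin_count n 1 x) = 4 ^ n"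
    using sum_spin_weights[of "\<lambda>s. if s = 1 then 2 else 1" n] by simp
  also have "sqrt 2 ^ n * 4 ^ n = (4 * sqrt 2) ^ n" by (simp add: power_mult_distrib)
  finally have T: "(\<Sum>x\<in>?T. 4 ^ spin_count n 1 x) \<le> (4 * sqrt 2) ^ n" .
  have "(\<Sum>x\<in>?S. (4::real) ^ spin_count n 1 x) + (\<Sum>x\<in>?T. 4 ^ spin_count n 1 x)
      = (\<Sum>x\<in>?S \<union> ?T. 4 ^ spin_count n 1 x)"
    by (intro sum.union_disjoint[symmetric]) auto
  also have "?S \<union> ?T = potts_configs n" by auto
  also have "(\<Sum>x\<in>potts_configs n. (4::real) ^ spin_count n 1 x) = 6 ^ n"
    using sum_spin_weights[of "\<lambda>s. if s = 1 then 4 else 1" n] by simp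
  finally have "6 ^ n / 2 \<le> (\<Sum>x\<in>?S. (4::real) ^ spin_count n 1 x)" using T big by linarith
  then have "exp (- (real n / 3 + 2) * ln 2) * (6 ^ n / 2) \<le>
      exp (- (real n / 3 + 2) * ln 2) * (\<Sum>x\<in>?S. (4::real) ^ spin_count n 1 x)"
    by (intro mult_left_mono) auto
  also have "\<dots> \<le> potts_weight n (4 * ln 2 / real n) ?S"
    unfolding potts_weight_def sum_distrib_left by (intro sum_mono pt) auto
  finally have "exp (- (real n / 3 + 2) * ln 2) * (6 ^ n / 2) \<le> potts_weight n (4 * ln 2 / real n) ?S" .
  moreover have "exp (real n * ln 3 + (2 / 3 * real n - 2) * ln 2) =
      exp (- (real n / 3 + 2) * ln 2) * 6 ^ n"
  proof -
    have "ln (6::real) = ln 2 + ln 3" using ln_mult[of 2 "3::real"] by simp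
    moreover have "(6::real) ^ n = exp (real n * ln 6)" by (simp add: exp_of_nat_mult)
    ultimately show ?thesis by (simp add: exp_add[symmetric] algebra_simps)
  qed
  ultimately show ?thesis by simp
qed

section \<open>The bottleneck of the tempering chain\<close>

text \<open>Exchanging spins 1 and \<open>s\<close> preserves the energy.\<close>

lemma potts_weight_spin_symmetry:
  assumes s: "s \<in> {1, 2, 3}"
  shows "potts_weight n \<beta> {x \<in> potts_configs n. P (spin_count n s x)} =
    potts_weight n \<beta> {x \<in> potts_configs n. P (spin_count n 1 x)}"
proof -
  \<comment> \<open>The restriction keeps the relabelled configuration extensional, as
    \<open>potts_configs\<close> demands.\<close>
  define f where "f = (\<lambda>x::nat \<Rightarrow> nat. restrict (\<lambda>v. transpose 1 s (x v)) {1..n})"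
  have f_in: "f x \<in> potts_configs n" if "x \<in> potts_configs n" for x
    using that s unfolding f_def potts_configs_def
    by (auto simp: PiE_iff transpose_def)
  have ff: "f (f x) = x" if "x \<in> potts_configs n" for x
    using that unfolding f_def potts_configs_def
    by (auto simp: fun_eq_iff PiE_iff extensional_def)
  have cnt: "spin_count n t (f x) = spin_count n (transpose 1 s t) x" for t x
  proof -
    have "{v \<in> {1..n}. f x v = t} = {v \<in> {1..n}. x v = transpose 1 s t}"
      by (auto simp: f_def transpose_def split: if_splits)
    then show ?thesis by (simp add: spin_count_def)
  qed
  have H: "potts_H n (f x) = potts_H n x" for x
    unfolding potts_H_def by (intro sum.cong refl) (auto simp: f_def transpose_def split: if_splits)
  show ?thesis unfolding potts_weight_def
    by (rule sum.reindex_bij_witness[of _ f f]) (auto simp: f_in ff cnt H simp del: One_nat_def)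
qed

text \<open>Some spin occupies at least a third of the sites. By symmetry it may be taken to be spin
  1, and its count is then split at \<open>n / 2\<close>.\<close>

lemma potts_Z_le_weights:
  "potts_Z n \<beta> \<le> 3 * potts_weight n \<beta> {x \<in> potts_configs n. n < 2 * spin_count n 1 x}
    + 3 * potts_weight n \<beta> {x \<in> potts_configs n. n \<le> 3 * spin_count n 1 x \<and> 2 * spin_count n 1 x \<le> n}"
proof -
  define A where "A = (\<lambda>s. {x \<in> potts_configs n. n \<le> 3 * spin_count n s x})"
  define S where "S = (\<lambda>s. {x \<in> potts_configs n. n < 2 * spin_count n s x})"
  define E where "E = (\<lambda>s. {x \<in> potts_configs n. n \<le> 3 * spin_count n s x \<and> 2 * spin_count n s x \<le> n})"
  have fin: "finite (A s)" "finite (S s)" "finite (E s)" for s by (simp_all add: A_def S_def E_def)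
  have Un: "potts_weight n \<beta> (C \<union> D) \<le> potts_weight n \<beta> C + potts_weight n \<beta> D"
    if "finite C" "finite D" for C D
    using sum.union_inter[OF that, of "\<lambda>x. exp (\<beta> * real (potts_H n x))"]
      potts_weight_nonneg[of n \<beta> "C \<inter> D"]
    unfolding potts_weight_def by linarith
  have "potts_configs n = A 1 \<union> A 2 \<union> A 3"
    using spin_count_total[of _ n] by (fastforce simp: A_def)
  then have "potts_Z n \<beta> \<le> potts_weight n \<beta> (A 1) + potts_weight n \<beta> (A 2) + potts_weight n \<beta> (A 3)"
    using Un[of "A 1 \<union> A 2" "A 3"] Un[of "A 1" "A 2"] fin
    by (simp add: potts_Z_def potts_weight_def)
  moreover have "potts_weight n \<beta> (A s) = potts_weight n \<beta> (A 1)" if "s \<in> {1, 2, 3}" for s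
    unfolding A_def by (rule potts_weight_spin_symmetry[OF that])
  from this[of 2] this[of 3]
  have "potts_weight n \<beta> (A 2) = potts_weight n \<beta> (A 1)" "potts_weight n \<beta> (A 3) = potts_weight n \<beta> (A 1)"
    by simp_all
  moreover have "potts_weight n \<beta> (A 1) \<le> potts_weight n \<beta> (S 1) + potts_weight n \<beta> (E 1)"
  proof -
    have "A 1 = S 1 \<union> E 1" by (auto simp: A_def S_def E_def)
    then show ?thesis using Un fin by metis
  qed
  ultimately show ?thesis by (simp add: S_def E_def)
qed

text \<open>Strict majorities of spins 1 and 2 exclude each other and have equal weight. This makes
  the bottleneck set admissible for the conductance.\<close>

lemma sum_gibbs_majority_le_half:
  "sum (potts_gibbs n \<beta>) {x \<in> potts_configs n. n < 2 * spin_count n 1 x} \<le> 1 / 2"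
proof -
  define S where "S = (\<lambda>s. {x \<in> potts_configs n. n < 2 * spin_count n s x})"
  have "potts_weight n \<beta> (S 1) + potts_weight n \<beta> (S 2) = potts_weight n \<beta> (S 1 \<union> S 2)"
    unfolding potts_weight_def
    by (rule sum.union_disjoint[symmetric]) (use spin_count_total[of _ n] in \<open>fastforce simp: S_def\<close>)+
  also have "\<dots> \<le> potts_Z n \<beta>"
    unfolding potts_weight_def potts_Z_def by (intro sum_mono2) (auto simp: S_def)
  also have "potts_weight n \<beta> (S 2) = potts_weight n \<beta> (S 1)"
    unfolding S_def by (rule potts_weight_spin_symmetry) simp
  finally show ?thesis unfolding sum_potts_gibbs S_def
    using potts_Z_pos[of n \<beta>] by (simp add: field_simps)
qed

section \<open>Moves across the boundary\<close>

lemma spin_proposal_nonneg: "0 \<le> spin_proposal n x y"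
  unfolding spin_proposal_def by (intro sum_nonneg) auto

lemma sum_spin_proposal_le: "finite Y \<Longrightarrow> (\<Sum>y\<in>Y. spin_proposal n x y) \<le> 1"
proof -
  assume Y: "finite Y"
  have "(\<Sum>y\<in>Y. spin_proposal n x y) =
      (\<Sum>v\<in>{1..n}. \<Sum>y\<in>Y. \<Sum>s\<in>{1, 2, 3}. if x(v := s) = y then 1 / (3 * real n) else 0)"
    unfolding spin_proposal_def by (rule sum.swap)
  also have "\<dots> = (\<Sum>v\<in>{1..n}. \<Sum>s\<in>{1, 2, 3}. \<Sum>y\<in>Y. if x(v := s) = y then 1 / (3 * real n) else 0)"
    by (intro sum.cong refl sum.swap)
  also have "\<dots> \<le> (\<Sum>v\<in>{1..n}. \<Sum>s\<in>{1, 2, 3::nat}. 1 / (3 * real n))"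
    using Y by (intro sum_mono) (auto simp: sum.delta)
  also have "\<dots> \<le> 1" by simp
  finally show ?thesis .
qed

lemma spin_count_fun_upd_le: "spin_count n s x \<le> spin_count n s (x(v := t)) + 1"
proof -
  have "{u \<in> {1..n}. x u = s} \<subseteq> insert v {u \<in> {1..n}. (x(v := t)) u = s}" by auto
  then have "spin_count n s x \<le> card (insert v {u \<in> {1..n}. (x(v := t)) u = s})"
    unfolding spin_count_def by (intro card_mono) auto
  also have "\<dots> \<le> spin_count n s (x(v := t)) + 1"
    unfolding spin_count_def using card_insert_le_m1 by (simp add: card_insert_if)
  finally show ?thesis .
qed

lemma spin_proposal_eq_0:
  assumes "spin_count n t y + 1 < spin_count n t x"
  shows "spin_proposal n x y = 0"
proof -
  have "x(v := s) \<noteq> y" for v s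
    using spin_count_fun_upd_le[of n t x v s] assms by auto
  then show ?thesis by (simp add: spin_proposal_def)
qed

lemma metropolis_le_spin_proposal:
  assumes "x \<noteq> y"
  shows "metropolis n \<rho> x y \<le> spin_proposal n x y"
proof -
  have "spin_proposal n x y * min 1 (\<rho> y / \<rho> x) \<le> spin_proposal n x y * 1"
    by (intro mult_left_mono spin_proposal_nonneg) simp
  then show ?thesis using assms by (simp add: metropolis_def chain_of_moves_def)
qed

text \<open>Temperature moves keep the configuration, so only level moves join distinct
  configurations; their factor \<open>1 / 4\<close> is dropped.\<close>

lemma tempering_chain_le:
  assumes "x \<noteq> y"
  shows "tempering_chain n M \<beta> (x, i) (y, j) \<le> (if j = i then spin_proposal n x y else 0)"
  using metropolis_le_spin_proposal[OF assms, of n "potts_gibbs n (\<beta> i)"]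
    spin_proposal_nonneg[of n x y] assms
  by (auto simp: tempering_chain_def chain_of_moves_def)

lemma potts_gibbs_nonneg: "0 \<le> potts_gibbs n \<beta> x"
  unfolding potts_gibbs_def using potts_Z_pos[of n \<beta>] by simp

text \<open>The test set is \<open>S\<close> at all levels. Its outflow is at most the level average
  of the masses of \<open>B\<close>, while the top level alone gives it mass
  \<open>w / (M + 1)\<close>.\<close>

lemma conductance_tempering_le:
  fixes n M :: nat and \<beta> :: "nat \<Rightarrow> real"
  defines "S \<equiv> {x \<in> potts_configs n. n < 2 * spin_count n 1 x}"
    and "B \<equiv> {x \<in> potts_configs n. n < 2 * spin_count n 1 x \<and> 2 * spin_count n 1 x \<le> n + 2}"
  assumes bd: "\<And>i. i \<le> M \<Longrightarrow> sum (potts_gibbs n (\<beta> i)) B \<le> \<delta>"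
    and w: "0 < w" "w \<le> sum (potts_gibbs n (\<beta> M)) S"
  shows "conductance (tempering_states n M) (tempering_dist n M \<beta>) (tempering_chain n M \<beta>)
    \<le> \<delta> * (real M + 1) / w"
proof -
  let ?X = "tempering_states n M" and ?\<pi> = "tempering_dist n M \<beta>" and ?P = "tempering_chain n M \<beta>"
  let ?S = "S \<times> {0..M}"
  have fin: "finite S" "finite B" "finite ?X" by (simp_all add: S_def B_def tempering_states_def)
  have sub: "?S \<subseteq> ?X" by (auto simp: S_def tempering_states_def)
  have mass: "sum ?\<pi> (A \<times> {0..M}) = (\<Sum>i\<in>{0..M}. sum (potts_gibbs n (\<beta> i)) A) / (real M + 1)" for A
    unfolding tempering_dist_def sum.cartesian_product[symmetric]
    by (subst sum.swap) (simp add: sum_divide_distrib)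
  have g0: "0 \<le> sum (potts_gibbs n (\<beta> i)) A" for i A
    by (intro sum_nonneg potts_gibbs_nonneg)
  have "w \<le> (\<Sum>i\<in>{0..M}. sum (potts_gibbs n (\<beta> i)) S)"
    using w(2) member_le_sum[of M "{0..M}" "\<lambda>i. sum (potts_gibbs n (\<beta> i)) S"] g0 by fastforce
  then have lower: "w / (real M + 1) \<le> sum ?\<pi> ?S" unfolding mass by (intro divide_right_mono) auto
  have pos: "0 < sum ?\<pi> ?S"
    by (rule less_le_trans[OF _ lower]) (use w in \<open>auto intro!: divide_pos_pos\<close>)
  have half: "sum ?\<pi> ?S \<le> 1 / 2"
  proof -
    have "(\<Sum>i\<in>{0..M}. sum (potts_gibbs n (\<beta> i)) S) \<le> real (card {0..M}) * (1 / 2)"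
      unfolding S_def by (intro sum_bounded_above sum_gibbs_majority_le_half)
    then show ?thesis unfolding mass by (simp add: field_simps)
  qed
  have \<pi>0: "0 \<le> ?\<pi> u" for u by (auto simp: tempering_dist_def potts_gibbs_nonneg split: prod.split)
  have out: "(\<Sum>v\<in>?X - ?S. ?P (x, i) v) \<le> (if x \<in> B then 1 else 0)"
    if xi: "x \<in> S" "i \<le> M" for x i
  proof -
    have le: "?P (x, i) (y, j) \<le> (if j = i then spin_proposal n x y else 0)"
      if "(y, j) \<in> ?X - ?S" for y j
      using that xi by (intro tempering_chain_le) (auto simp: tempering_states_def)
    show ?thesis
    proof (cases "x \<in> B")
      case True
      have "(\<Sum>v\<in>?X - ?S. ?P (x, i) v) \<le> (\<Sum>(y, j)\<in>?X - ?S. if j = i then spin_proposal n x y else 0)"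
      proof (rule sum_mono)
        fix v assume "v \<in> ?X - ?S"
        then show "?P (x, i) v \<le> (case v of (y, j) \<Rightarrow> if j = i then spin_proposal n x y else 0)"
          using le by (cases v) simp
      qed
      also have "\<dots> \<le> (\<Sum>(y, j)\<in>?X. if j = i then spin_proposal n x y else 0)"
        using fin by (intro sum_mono2) (auto simp: spin_proposal_nonneg)
      also have "\<dots> = (\<Sum>y\<in>potts_configs n. spin_proposal n x y)"
        unfolding tempering_states_def sum.cartesian_product[symmetric]
        using xi by (simp add: sum.delta)
      also have "\<dots> \<le> 1" by (rule sum_spin_proposal_le) simp
      finally show ?thesis using True by simp
    next
      case False
      have "?P (x, i) v \<le> 0" if v: "v \<in> ?X - ?S" for v
      proof -
        obtain y j where yj: "v = (y, j)" by (cases v)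
        \<comment> \<open>Outside \<open>B\<close> the count of \<open>x\<close> exceeds
          \<open>n / 2 + 1\<close>, whereas that of \<open>y\<close> is at most
          \<open>n / 2\<close>.\<close>
        have "spin_count n 1 y + 1 < spin_count n 1 x"
          using False xi v by (auto simp: yj S_def B_def tempering_states_def)
        then have "spin_proposal n x y = 0" by (rule spin_proposal_eq_0)
        then show ?thesis using le[of y j] v by (auto simp: yj split: if_splits)
      qed
      then have "(\<Sum>v\<in>?X - ?S. ?P (x, i) v) \<le> 0" by (rule sum_nonpos)
      then show ?thesis using False by simp
    qed
  qed
  have "(\<Sum>u\<in>?S. \<Sum>v\<in>?X - ?S. ?\<pi> u * ?P u v) \<le> (\<Sum>u\<in>?S. if u \<in> B \<times> {0..M} then ?\<pi> u else 0)"
  proof (rule sum_mono)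
    fix u assume u: "u \<in> ?S"
    obtain x i where xi: "u = (x, i)" by (cases u)
    have "(\<Sum>v\<in>?X - ?S. ?\<pi> u * ?P u v) = ?\<pi> u * (\<Sum>v\<in>?X - ?S. ?P u v)"
      by (simp add: sum_distrib_left)
    also have "\<dots> \<le> ?\<pi> u * (if x \<in> B then 1 else 0)"
      using u out[of x i] unfolding xi by (intro mult_left_mono \<pi>0) auto
    finally show "(\<Sum>v\<in>?X - ?S. ?\<pi> u * ?P u v) \<le> (if u \<in> B \<times> {0..M} then ?\<pi> u else 0)"
      using u by (auto simp: xi)
  qed
  also have "\<dots> = sum ?\<pi> (B \<times> {0..M})"
  proof -
    have "?S \<inter> B \<times> {0..M} = B \<times> {0..M}" by (auto simp: S_def B_def)
    then show ?thesis using fin by (simp add: sum.If_cases)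
  qed
  also have "\<dots> \<le> \<delta>"
  proof -
    have "(\<Sum>i\<in>{0..M}. sum (potts_gibbs n (\<beta> i)) B) \<le> real (card {0..M}) * \<delta>"
      by (intro sum_bounded_above bd) auto
    then show ?thesis unfolding mass by (simp add: field_simps)
  qed
  finally have flow: "(\<Sum>u\<in>?S. \<Sum>v\<in>?X - ?S. ?\<pi> u * ?P u v) \<le> \<delta>" .
  have "0 \<le> \<delta>" using bd[of 0] g0[of 0 B] by simp
  have "conductance ?X ?\<pi> ?P \<le> (\<Sum>u\<in>?S. \<Sum>v\<in>?X - ?S. ?\<pi> u * ?P u v) / sum ?\<pi> ?S"
    unfolding conductance_def using fin sub pos half by (intro Min_le) (auto intro!: imageI)
  also have "\<dots> \<le> \<delta> / (w / (real M + 1))"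
    using flow lower \<open>0 \<le> \<delta>\<close> w by (intro frac_le) auto
  finally show ?thesis by simp
qed

section \<open>Asymptotics and conclusion\<close>

lemma eventually_powers_le_exp:
  fixes c C :: real
  assumes "0 < c"
  shows "\<forall>\<^sub>F n in sequentially. C * real n ^ j \<le> exp (c * real n)"
proof -
  have lim: "filterlim (\<lambda>n. c * real n) at_top sequentially"
    using assms by (intro filterlim_tendsto_pos_mult_at_top[OF tendsto_const] filterlim_real_sequentially)
  have "((\<lambda>n. C / c ^ j * ((c * real n) ^ j / exp (c * real n))) \<longlongrightarrow> C / c ^ j * 0) sequentially"
    by (intro tendsto_mult tendsto_const filterlim_compose[OF tendsto_power_div_exp_0 lim])
  then have "\<forall>\<^sub>F n in sequentially. C / c ^ j * ((c * real n) ^ j / exp (c * real n)) < 1"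
    by (rule order_tendstoD) simp
  then show ?thesis
    by eventually_elim (use assms in \<open>simp add: power_mult_distrib field_simps\<close>)
qed

text \<open>At the critical temperature the bounds for the ordered and the intermediate weights
  share the same exponential, so the whole of \<open>potts_Z\<close> is at most a polynomial
  multiple of the majority weight.\<close>

lemma sum_gibbs_majority_ge:
  assumes n: "3 \<le> n" and big: "2 * (4 * sqrt 2) ^ n \<le> (6::real) ^ n"
  shows "1 / (3 + 6 * (real n + 1)\<^sup>2) \<le>
    sum (potts_gibbs n (4 * ln 2 / real n)) {x \<in> potts_configs n. n < 2 * spin_count n 1 x}"
proof -
  let ?b = "4 * ln 2 / real n"
  define W where "W = potts_weight n ?b {x \<in> potts_configs n. n < 2 * spin_count n 1 x}"
  define E where "E = potts_weight n ?b {x \<in> potts_configs n. n \<le> 3 * spin_count n 1 x \<and> 2 * spin_count n 1 x \<le> n}"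
  define K where "K = exp (real n * ln 3 + (2 / 3 * real n - 2) * ln 2)"
  have K: "K \<le> 2 * W" using potts_weight_ordered_ge[of n] n big by (simp add: K_def W_def)
  have "E \<le> (real n + 1)\<^sup>2 * K"
    unfolding E_def K_def by (rule potts_weight_disordered_le[OF n])
  also have "\<dots> \<le> (real n + 1)\<^sup>2 * (2 * W)" by (intro mult_left_mono K) simp
  finally have "potts_Z n ?b \<le> (3 + 6 * (real n + 1)\<^sup>2) * W"
    using potts_Z_le_weights[of n ?b] unfolding W_def[symmetric] E_def[symmetric]
    by (simp add: distrib_right)
  moreover have "0 < 3 + 6 * (real n + 1)\<^sup>2" by (simp add: add_pos_nonneg)
  ultimately show ?thesis
    unfolding sum_potts_gibbs W_def[symmetric] using potts_Z_pos[of n ?b]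
    by (simp add: field_simps)
qed

text \<open>Polynomially many levels are expressed by an exponent \<open>k\<close>: the threshold
  for \<open>n\<close> may depend on it, \<open>c\<^sub>4\<close> may not.\<close>

theorem theorem7p2:
  shows "\<exists>c\<^sub>4::real. c\<^sub>4 > 0 \<and>
    (\<forall>k::nat. \<forall>\<^sub>F n::nat in sequentially. \<forall>(M::nat) (\<beta>::nat \<Rightarrow> real).
       M \<le> n ^ k \<and> 0 \<le> \<beta> 0 \<and> (\<forall>i<M. \<beta> i \<le> \<beta> (Suc i)) \<and> \<beta> M = 4 * ln 2 / real n \<longrightarrow>
       conductance (tempering_states n M) (tempering_dist n M \<beta>) (tempering_chain n M \<beta>)
         \<le> exp (- c\<^sub>4 * real n))"
proof -
  \<comment> \<open>Half of the rate gap; the other half absorbs the polynomial factors.\<close>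
  define c :: real where "c = (ln 3 - 19 / 12 * ln 2) / 2"
  \<comment> \<open>The gap is positive because \<open>2 ^ 19 < 3 ^ 12\<close>.\<close>
  have "ln (524288::real) = 19 * ln 2" "ln (531441::real) = 12 * ln 3"
    using ln_realpow[of "2::real" 19] ln_realpow[of "3::real" 12] by simp_all
  moreover have "ln (524288::real) < ln 531441" by (subst ln_less_cancel_iff) auto
  ultimately have "19 * ln 2 < 12 * ln (3::real)" by linarith
  then have c: "0 < c" by (simp add: c_def)
  have s2: "\<forall>\<^sub>F n in sequentially. 2 * (4 * sqrt 2) ^ n \<le> (6::real) ^ n"
  proof -
    have "sqrt 2 < 3 / (2::real)" by (rule real_less_lsqrt) (auto simp: power2_eq_square)
    then have "(\<lambda>n. (4 * sqrt 2 / 6) ^ n) \<longlonglongrightarrow> 0" by (intro LIMSEQ_power_zero) simp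
    then have "\<forall>\<^sub>F n in sequentially. (4 * sqrt 2 / 6) ^ n < 1 / 2" by (rule order_tendstoD) simp
    then show ?thesis
    proof eventually_elim
      case (elim n)
      then have "(4 * sqrt 2) ^ n / 6 ^ n < 1 / (2::real)" by (simp only: power_divide)
      then have "(4 * sqrt 2) ^ n < 1 / 2 * (6::real) ^ n" by (subst (asm) pos_divide_less_eq) simp_all
      then show ?case by linarith
    qed
  qed
  show ?thesis
  proof (intro exI[of _ c] conjI c allI)
    fix k :: nat
    show "\<forall>\<^sub>F n::nat in sequentially. \<forall>(M::nat) (\<beta>::nat \<Rightarrow> real).
       M \<le> n ^ k \<and> 0 \<le> \<beta> 0 \<and> (\<forall>i<M. \<beta> i \<le> \<beta> (Suc i)) \<and> \<beta> M = 4 * ln 2 / real n \<longrightarrow>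
       conductance (tempering_states n M) (tempering_dist n M \<beta>) (tempering_chain n M \<beta>)
         \<le> exp (- c * real n)"
      \<comment> \<open>The prefactors are at most \<open>(2 n)\<^sup>2\<close>,
        \<open>2 n ^ k\<close>, \<open>27 n\<^sup>2\<close> and \<open>8\<close>, with product
        \<open>1728 n ^ (k + 4)\<close>.\<close>
      using s2 eventually_powers_le_exp[OF c, of 1728 "k + 4"] eventually_ge_at_top[of 3]
    proof (eventually_elim, intro allI impI, elim conjE)
      fix n M :: nat and \<beta> :: "nat \<Rightarrow> real"
      assume big: "2 * (4 * sqrt 2) ^ n \<le> (6::real) ^ n"
        and pow: "1728 * real n ^ (k + 4) \<le> exp (c * real n)" and n: "3 \<le> n"
        and M: "M \<le> n ^ k" and \<beta>0: "0 \<le> \<beta> 0" and step: "\<forall>i<M. \<beta> i \<le> \<beta> (Suc i)"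
        and \<beta>M: "\<beta> M = 4 * ln 2 / real n"
      have mono: "\<beta> i \<le> \<beta> j" if "i \<le> j" "j \<le> M" for i j
        using that
      proof (induction rule: dec_induct)
        case (step m)
        then show ?case using \<open>\<forall>i<M. \<beta> i \<le> \<beta> (Suc i)\<close> by (meson Suc_le_lessD Suc_leD order_trans)
      qed simp
      let ?\<delta> = "(real n + 1)\<^sup>2 * exp (3 * ln 2 - real n * (ln 3 - 19 / 12 * ln 2))"
      let ?w = "1 / (3 + 6 * (real n + 1)\<^sup>2)"
      have "conductance (tempering_states n M) (tempering_dist n M \<beta>) (tempering_chain n M \<beta>)
          \<le> ?\<delta> * (real M + 1) / ?w"
      proof (rule conductance_tempering_le)
        fix i assume "i \<le> M"
        then show "sum (potts_gibbs n (\<beta> i)) {x \<in> potts_configs n. n < 2 * spin_count n 1 x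
            \<and> 2 * spin_count n 1 x \<le> n + 2} \<le> ?\<delta>"
          using mono[of 0 i] mono[of i M] \<beta>0 \<beta>M n by (intro sum_gibbs_boundary_le) auto
      next
        show "?w \<le> sum (potts_gibbs n (\<beta> M)) {x \<in> potts_configs n. n < 2 * spin_count n 1 x}"
          unfolding \<beta>M by (rule sum_gibbs_majority_ge[OF n big])
      qed (simp add: add_pos_nonneg)
      also have "\<dots> = (real n + 1)\<^sup>2 * (real M + 1) * (3 + 6 * (real n + 1)\<^sup>2) * 8 * exp (- 2 * c * real n)"
      proof -
        have "exp (3 * ln (2::real)) = 8" using exp_of_nat_mult[of 3 "ln (2::real)"] by simp
        moreover have "3 * ln 2 - real n * (ln 3 - 19 / 12 * ln 2) = 3 * ln 2 + - 2 * c * real n"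
          by (simp add: c_def field_simps)
        ultimately show ?thesis by (simp only: exp_add) simp
      qed
      also have "\<dots> \<le> (1728 * real n ^ (k + 4)) * exp (- 2 * c * real n)"
      proof (rule mult_right_mono)
        have n1: "(real n + 1)\<^sup>2 \<le> (2 * real n)\<^sup>2" using n by (intro power_mono) auto
        have one: "1 \<le> real n ^ j" for j using n by (intro one_le_power) auto
        have "real M \<le> real n ^ k" using M by (metis of_nat_le_iff of_nat_power)
        then have M1: "real M + 1 \<le> 2 * real n ^ k" using one[of k] by linarith
        have "3 + 6 * (real n + 1)\<^sup>2 \<le> 27 * real n ^ 2"
          using n1 one[of 2] by (simp add: power_mult_distrib)
        then have "(real n + 1)\<^sup>2 * (real M + 1) * (3 + 6 * (real n + 1)\<^sup>2) \<le>
            (2 * real n)\<^sup>2 * (2 * real n ^ k) * (27 * real n ^ 2)"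
          using n1 M1 by (intro mult_mono) auto
        also have "\<dots> = 216 * real n ^ (k + 4)"
          by (simp add: power_add power2_eq_square power4_eq_xxxx)
        finally show "(real n + 1)\<^sup>2 * (real M + 1) * (3 + 6 * (real n + 1)\<^sup>2) * 8 \<le> 1728 * real n ^ (k + 4)"
          by linarith
      qed simp
      also have "\<dots> \<le> exp (c * real n) * exp (- 2 * c * real n)"
        by (intro mult_right_mono pow) simp
      also have "\<dots> = exp (- c * real n)" by (simp add: exp_add[symmetric])
      finally show "conductance (tempering_states n M) (tempering_dist n M \<beta>) (tempering_chain n M \<beta>)
         \<le> exp (- c * real n)" .
    qed
  qed
qed

end
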